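(* For every natural number $n \geq 0$, the empty clause $\vdash$ is derivable by resolution from the clause set $C(n)$.
   Context: Work in a first-order language with a constant $0$, unary function symbols $s$ and $f$, a binary function symbol $\max$, a binary predicate symbol $\leq$, and atoms of the form $f(t)=k$ where $t$ is a term and $k$ is a numeral; here $=$ is an uninterpreted binary predicate (no equality axioms are assumed). A clause is a sequent $\Pi \vdash \Delta$ of finite multisets of atoms; its variables are implicitly universally quantified. For $n\ge 0$, the clause set $C(n)$ consists of the following clauses, where $\alpha,\beta,\gamma$ are variables: (C1) $\vdash \alpha \leq \alpha$; (C2) $\max(\alpha,\beta)\leq\gamma \vdash \alpha\leq\gamma$; (C3) $\max(\alpha,\beta)\leq\gamma \vdash \beta\leq\gamma$; (C4$(k)$) $f(\beta)=k,\ f(\alpha)=k,\ s(\beta)\leq\alpha \vdash$, one for each $k$ with $0\le k\le n$; (C5) $\vdash f(\alpha)=0, f(\alpha)=1,\ldots, f(\alpha)=n$. A clause is derivable by resolution from $C(n)$ if it is obtained in finitely many steps from variable-renamed copies of clauses of $C(n)$ using: the resolution rule (from $\Pi\vdash P,\Delta$ and $\Pi',P'\vdash\Delta'$ and a substitution $\sigma$ with $P\sigma=P'\sigma$, infer $\Pi\sigma,\Pi'\sigma\vdash\Delta\sigma,\Delta'\sigma$) and contraction (merging identical atoms on the same side of a clause). *)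

theory Defs
  imports "HOL-Library.Multiset"
begin

datatype tm =
    Var nat
  | Zero
  | Succ tm
  | Fun tm
  | Maxi tm tm

text \<open>Numerals are the terms $s^k(0)$. The constructor \<open>Eq\<close> is an ordinary binary
  predicate symbol without equality axioms; it is only used in atoms $f(t) = k$ with $k$ a
  numeral, a form that is closed under substitution.\<close>

datatype atom =
    Leq tm tm
  | Eq tm tm

primrec numeral_tm :: "nat \<Rightarrow> tm" where
  "numeral_tm 0 = Zero"
| "numeral_tm (Suc k) = Succ (numeral_tm k)"

definition fun_eq :: "tm \<Rightarrow> nat \<Rightarrow> atom" where
  "fun_eq t k = Eq (Fun t) (numeral_tm k)"

datatype clause = Sequent (ante: "atom multiset") (succd: "atom multiset")  (infix "\<turnstile>" 50)

type_synonym subst = "nat \<Rightarrow> tm"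

primrec subst_tm :: "subst \<Rightarrow> tm \<Rightarrow> tm" where
  "subst_tm \<sigma> (Var x) = \<sigma> x"
| "subst_tm \<sigma> Zero = Zero"
| "subst_tm \<sigma> (Succ t) = Succ (subst_tm \<sigma> t)"
| "subst_tm \<sigma> (Fun t) = Fun (subst_tm \<sigma> t)"
| "subst_tm \<sigma> (Maxi t u) = Maxi (subst_tm \<sigma> t) (subst_tm \<sigma> u)"

primrec subst_atom :: "subst \<Rightarrow> atom \<Rightarrow> atom" where
  "subst_atom \<sigma> (Leq t u) = Leq (subst_tm \<sigma> t) (subst_tm \<sigma> u)"
| "subst_atom \<sigma> (Eq t u) = Eq (subst_tm \<sigma> t) (subst_tm \<sigma> u)"

primrec subst_clause :: "subst \<Rightarrow> clause \<Rightarrow> clause" where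
  "subst_clause \<sigma> (\<Pi> \<turnstile> \<Delta>) =
    (image_mset (subst_atom \<sigma>) \<Pi> \<turnstile> image_mset (subst_atom \<sigma>) \<Delta>)"

definition rename_clause :: "(nat \<Rightarrow> nat) \<Rightarrow> clause \<Rightarrow> clause" where
  "rename_clause \<rho> = subst_clause (\<lambda>x. Var (\<rho> x))"

text \<open>As in the usual sequent presentation of resolution, \<open>\<sigma>\<close> may be any unifier of the two
  resolved atoms; it need not be most general, and the premises need not be variable-disjoint.
  Variable renaming takes place only at the leaves.\<close>

inductive derivable :: "clause set \<Rightarrow> clause \<Rightarrow> bool" for N :: "clause set" where
  initial: "C \<in> N \<Longrightarrow> inj \<rho> \<Longrightarrow> derivable N (rename_clause \<rho> C)"
| resolution:
    "derivable N (\<Pi> \<turnstile> add_mset P \<Delta>) \<Longrightarrow> derivable N (add_mset P' \<Pi>' \<turnstile> \<Delta>') \<Longrightarrow>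
     subst_atom \<sigma> P = subst_atom \<sigma> P' \<Longrightarrow>
     derivable N (subst_clause \<sigma> (\<Pi> + \<Pi>' \<turnstile> \<Delta> + \<Delta>'))"
| contraction_left:
    "derivable N (add_mset A (add_mset A \<Pi>) \<turnstile> \<Delta>) \<Longrightarrow> derivable N (add_mset A \<Pi> \<turnstile> \<Delta>)"
| contraction_right:
    "derivable N (\<Pi> \<turnstile> add_mset A (add_mset A \<Delta>)) \<Longrightarrow> derivable N (\<Pi> \<turnstile> add_mset A \<Delta>)"

abbreviation var_a :: tm ("\<alpha>") where "\<alpha> \<equiv> Var 0"
abbreviation var_b :: tm ("\<beta>") where "\<beta> \<equiv> Var 1"
abbreviation var_c :: tm ("\<gamma>") where "\<gamma> \<equiv> Var 2"

definition clause_set :: "nat \<Rightarrow> clause set" where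
  "clause_set n =
    {{#} \<turnstile> {#Leq \<alpha> \<alpha>#},
     {#Leq (Maxi \<alpha> \<beta>) \<gamma>#} \<turnstile> {#Leq \<alpha> \<gamma>#},
     {#Leq (Maxi \<alpha> \<beta>) \<gamma>#} \<turnstile> {#Leq \<beta> \<gamma>#}}
    \<union> {{#fun_eq \<beta> k, fun_eq \<alpha> k, Leq (Succ \<beta>) \<alpha>#} \<turnstile> {#} | k. k \<le> n}
    \<union> {{#} \<turnstile> image_mset (fun_eq \<alpha>) (mset [0..<Suc n])}"

end

(* Put t 0 = 0 and t (j + 1) = max (s (t j)) (t j). Then s (t i) <= t j is derivable for all i < j,
   so t 0, ..., t (n + 1) must receive pairwise different values among 0, ..., n. This instance of
   the pigeonhole principle is refuted propositionally by going down the semantic tree that decides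
   the values of f (t 0), f (t 1), ... in turn. The propositional derivation is lifted by renaming
   premises apart, using that any unifier may be chosen: a resolvent is derivable together with all
   of its instances. *)
theory Submission
  imports Defs
begin

section \<open>Lifting\<close>

lemma subst_tm_subst_tm:
  "subst_tm \<sigma> (subst_tm \<tau> t) = subst_tm (\<lambda>x. subst_tm \<sigma> (\<tau> x)) t"
  by (induction t) auto

lemma subst_atom_subst_atom:
  "subst_atom \<sigma> (subst_atom \<tau> a) = subst_atom (\<lambda>x. subst_tm \<sigma> (\<tau> x)) a"
  by (cases a) (auto simp: subst_tm_subst_tm)

lemma subst_clause_subst_clause:
  "subst_clause \<sigma> (subst_clause \<tau> C) = subst_clause (\<lambda>x. subst_tm \<sigma> (\<tau> x)) C"
  by (cases C) (auto simp: subst_atom_subst_atom image_mset.compositionality comp_def)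

lemma subst_tm_Var [simp]: "subst_tm Var t = t"
  by (induction t) auto

lemma subst_atom_Var [simp]: "subst_atom Var = (\<lambda>a. a)"
proof
  show "subst_atom Var a = a" for a by (cases a) auto
qed

lemma subst_clause_Var [simp]: "subst_clause Var C = C"
  by (cases C) simp

lemma subst_tm_numeral_tm [simp]: "subst_tm \<sigma> (numeral_tm k) = numeral_tm k"
  by (induction k) auto

lemma subst_atom_fun_eq [simp]: "subst_atom \<sigma> (fun_eq t k) = fun_eq (subst_tm \<sigma> t) k"
  by (simp add: fun_eq_def)

definition all_inst_derivable :: "clause set \<Rightarrow> clause \<Rightarrow> bool" where
  "all_inst_derivable N C \<longleftrightarrow> (\<forall>\<sigma>. derivable N (subst_clause \<sigma> C))"

text \<open>Instances of initial clauses are in general not derivable, but they are liftable.\<close>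

definition liftable :: "clause set \<Rightarrow> clause \<Rightarrow> bool" where
  "liftable N C \<longleftrightarrow>
    (\<exists>D \<tau>. C = subst_clause \<tau> D \<and> (\<forall>\<rho>. inj \<rho> \<longrightarrow> derivable N (rename_clause \<rho> D)))"

lemma all_inst_derivable_imp_derivable: "all_inst_derivable N C \<Longrightarrow> derivable N C"
  unfolding all_inst_derivable_def by (metis subst_clause_Var)

lemma all_inst_derivable_imp_liftable: "all_inst_derivable N C \<Longrightarrow> liftable N C"
  unfolding all_inst_derivable_def liftable_def rename_clause_def by (metis subst_clause_Var)

lemma liftable_initial: "D \<in> N \<Longrightarrow> liftable N (subst_clause \<tau> D)"
  unfolding liftable_def by (metis initial)

text \<open>Since \<open>resolution\<close> accepts any unifier, once the premises are renamed apart
  a single substitution can both instantiate them and produce the \<open>\<sigma>\<close>-instance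
  of the resolvent.\<close>

lemma all_inst_derivable_resolution:
  assumes "liftable N (\<Pi> \<turnstile> add_mset P \<Delta>)" and "liftable N (add_mset P \<Pi>' \<turnstile> \<Delta>')"
  shows "all_inst_derivable N (\<Pi> + \<Pi>' \<turnstile> \<Delta> + \<Delta>')"
  unfolding all_inst_derivable_def
proof
  fix \<sigma>
  obtain D \<tau> where D: "\<Pi> \<turnstile> add_mset P \<Delta> = subst_clause \<tau> D"
    "\<And>\<rho>. inj \<rho> \<Longrightarrow> derivable N (rename_clause \<rho> D)"
    using assms(1) unfolding liftable_def by (elim exE conjE) (rule that, assumption, simp)
  obtain D' \<tau>' where D': "add_mset P \<Pi>' \<turnstile> \<Delta>' = subst_clause \<tau>' D'"
    "\<And>\<rho>. inj \<rho> \<Longrightarrow> derivable N (rename_clause \<rho> D')"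
    using assms(2) unfolding liftable_def by (elim exE conjE) (rule that, assumption, simp)
  \<comment> \<open>Even variables go to \<open>D\<close>, odd ones to \<open>D'\<close>; thus
    \<open>\<mu>\<close> can act as \<open>\<tau>\<close> followed by \<open>\<sigma>\<close> on one
    and as \<open>\<tau>'\<close> followed by \<open>\<sigma>\<close> on the other.\<close>
  define r r' where "r = (\<lambda>x::nat. 2 * x)" and "r' = (\<lambda>x::nat. Suc (2 * x))"
  define \<mu> where
    "\<mu> y = subst_tm \<sigma> (if even y then \<tau> (y div 2) else \<tau>' (y div 2))" for y :: nat
  have inj: "inj r" "inj r'"
    by (auto simp: r_def r'_def inj_def)
  have "derivable N (rename_clause r D)" "derivable N (rename_clause r' D')"
    by (rule D(2)[OF inj(1)], rule D'(2)[OF inj(2)])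
  moreover obtain E F where E: "rename_clause r D = (E \<turnstile> F)" by (cases "rename_clause r D")
  moreover obtain E' F' where E': "rename_clause r' D' = (E' \<turnstile> F')"
    by (cases "rename_clause r' D'")
  ultimately have der: "derivable N (E \<turnstile> F)" "derivable N (E' \<turnstile> F')" by simp_all
  have "subst_clause \<mu> (rename_clause r D) = subst_clause \<sigma> (\<Pi> \<turnstile> add_mset P \<Delta>)"
    and "subst_clause \<mu> (rename_clause r' D') = subst_clause \<sigma> (add_mset P \<Pi>' \<turnstile> \<Delta>')"
    unfolding D(1) D'(1) rename_clause_def subst_clause_subst_clause
    by (simp_all add: \<mu>_def r_def r'_def)
  then have eq: "image_mset (subst_atom \<mu>) E = image_mset (subst_atom \<sigma>) \<Pi>"
      "image_mset (subst_atom \<mu>) F = add_mset (subst_atom \<sigma> P) (image_mset (subst_atom \<sigma>) \<Delta>)"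
      "image_mset (subst_atom \<mu>) E' = add_mset (subst_atom \<sigma> P) (image_mset (subst_atom \<sigma>) \<Pi>')"
      "image_mset (subst_atom \<mu>) F' = image_mset (subst_atom \<sigma>) \<Delta>'"
    by (simp_all add: E E')
  \<comment> \<open>Only one preimage of the resolved atom is split off; any further atoms that
    \<open>\<mu>\<close> sends to it stay in \<open>G\<close>.\<close>
  obtain Q G where Q: "F = add_mset Q G" "subst_atom \<mu> Q = subst_atom \<sigma> P"
      "image_mset (subst_atom \<mu>) G = image_mset (subst_atom \<sigma>) \<Delta>"
    using msed_map_invR[OF eq(2)] by blast
  obtain Q' G' where Q': "E' = add_mset Q' G'" "subst_atom \<mu> Q' = subst_atom \<sigma> P"
      "image_mset (subst_atom \<mu>) G' = image_mset (subst_atom \<sigma>) \<Pi>'"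
    using msed_map_invR[OF eq(3)] by blast
  have "derivable N (subst_clause \<mu> (E + G' \<turnstile> G + F'))"
  proof (rule resolution)
    show "derivable N (E \<turnstile> add_mset Q G)" using der(1) Q(1) by simp
    show "derivable N (add_mset Q' G' \<turnstile> F')" using der(2) Q'(1) by simp
    show "subst_atom \<mu> Q = subst_atom \<mu> Q'" using Q(2) Q'(2) by simp
  qed
  then show "derivable N (subst_clause \<sigma> (\<Pi> + \<Pi>' \<turnstile> \<Delta> + \<Delta>'))"
    by (simp add: eq Q Q')
qed

lemma all_inst_derivable_contraction_left:
  assumes "all_inst_derivable N (add_mset A (add_mset A \<Pi>) \<turnstile> \<Delta>)"
  shows "all_inst_derivable N (add_mset A \<Pi> \<turnstile> \<Delta>)"
  unfolding all_inst_derivable_def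
proof
  fix \<sigma>
  show "derivable N (subst_clause \<sigma> (add_mset A \<Pi> \<turnstile> \<Delta>))"
    using assms[unfolded all_inst_derivable_def, rule_format, of \<sigma>]
    unfolding subst_clause.simps image_mset_add_mset by (rule contraction_left)
qed

text \<open>Contracting until a single copy of \<open>A\<close> is left ensures that a later
  resolution on \<open>A\<close> removes it altogether.\<close>

lemma all_inst_derivable_merge_left:
  assumes "all_inst_derivable N (add_mset A \<Pi> \<turnstile> \<Delta>)"
  shows "\<exists>\<Pi>'. set_mset \<Pi>' \<subseteq> set_mset \<Pi> - {A} \<and> all_inst_derivable N (add_mset A \<Pi>' \<turnstile> \<Delta>)"
  using assms
proof (induction "size \<Pi>" arbitrary: \<Pi> rule: less_induct)
  case less
  show ?case
  proof (cases "A \<in># \<Pi>")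
    case True
    then obtain \<Pi>'' where *: "\<Pi> = add_mset A \<Pi>''" by (metis multi_member_split)
    have "all_inst_derivable N (add_mset A \<Pi>'' \<turnstile> \<Delta>)"
      using less.prems all_inst_derivable_contraction_left unfolding * by blast
    from less.hyps[OF _ this] show ?thesis unfolding * by auto
  next
    case False
    then show ?thesis using less.prems by auto
  qed
qed

section \<open>Refuting the pigeonhole principle\<close>

text \<open>The alternatives are resolved away one by one while the antecedents accumulate inside
  \<open>S\<close>. As \<open>M\<close> is nonempty, at least one resolution takes place, and this
  is what strengthens \<open>liftable\<close> to \<open>all_inst_derivable\<close>.\<close>

lemma eliminate_disjuncts:
  assumes "liftable N (\<Pi> \<turnstile> image_mset A M)" and "M \<noteq> {#}" and "set_mset \<Pi> \<subseteq> S"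
    and "\<And>k. k \<in># M \<Longrightarrow>
      \<exists>\<Gamma>. set_mset \<Gamma> \<subseteq> S \<and> all_inst_derivable N (add_mset (A k) \<Gamma> \<turnstile> {#})"
  shows "\<exists>\<Gamma>. set_mset \<Gamma> \<subseteq> S \<and> all_inst_derivable N (\<Gamma> \<turnstile> {#})"
  using assms
proof (induction M arbitrary: \<Pi>)
  case empty
  then show ?case by simp
next
  case (add k M)
  obtain \<Gamma> where \<Gamma>: "set_mset \<Gamma> \<subseteq> S" "all_inst_derivable N (add_mset (A k) \<Gamma> \<turnstile> {#})"
    using add.prems(4)[of k] by auto
  have res: "all_inst_derivable N (\<Pi> + \<Gamma> \<turnstile> image_mset A M)"
    using all_inst_derivable_resolution[of N \<Pi> "A k" "image_mset A M" \<Gamma> "{#}"]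
      add.prems(1) all_inst_derivable_imp_liftable[OF \<Gamma>(2)] by simp
  have sub: "set_mset (\<Pi> + \<Gamma>) \<subseteq> S" using \<Gamma>(1) add.prems(3) by simp
  show ?case
  proof (cases "M = {#}")
    case True
    with res sub show ?thesis by (intro exI[of _ "\<Pi> + \<Gamma>"]) simp
  next
    case False
    from add.IH[OF all_inst_derivable_imp_liftable[OF res] False sub] add.prems(4)
    show ?thesis by simp
  qed
qed

text \<open>Read \<open>A i k\<close> as: pigeon \<open>i\<close> sits in hole
  \<open>k\<close>.\<close>

lemma pigeonhole_refutation:
  fixes A :: "nat \<Rightarrow> nat \<Rightarrow> atom"
  assumes total: "\<And>i. liftable N ({#} \<turnstile> image_mset (A i) (mset [0..<Suc n]))"
    and inj: "\<And>i j k. i < j \<Longrightarrow> k \<le> n \<Longrightarrow> all_inst_derivable N ({#A i k, A j k#} \<turnstile> {#})"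
  shows "all_inst_derivable N ({#} \<turnstile> {#})"
proof -
  \<comment> \<open>The first \<open>m\<close> values of \<open>c\<close> form a node of the
    semantic tree; the claim is that some derivable clause is falsified there. The induction runs
    from depth \<open>n + 2\<close> down to the root.\<close>
  have "\<exists>\<Gamma>. set_mset \<Gamma> \<subseteq> (\<lambda>i. A i (c i)) ` {..<m} \<and> all_inst_derivable N (\<Gamma> \<turnstile> {#})"
    if "m \<le> n + 2" "\<And>i. c i \<le> n" for m and c :: "nat \<Rightarrow> nat"
    using that
  proof (induction m arbitrary: c rule: inc_induct)
    \<comment> \<open>A leaf places \<open>n + 2\<close> pigeons in the \<open>n + 1\<close> holes
      0, ..., \<open>n\<close>, so two of them collide.\<close>
    case base
    have "\<not> inj_on c {..<n + 2}"
    proof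
      assume "inj_on c {..<n + 2}"
      then have "card {..<n + 2} \<le> card {..n}"
        by (rule card_inj_on_le) (use base in auto)
      then show False by simp
    qed
    then obtain i j where "i < n + 2" "j < n + 2" "i \<noteq> j" "c i = c j"
      by (auto simp: inj_on_def)
    then obtain i j where ij: "i < j" "j < n + 2" "c i = c j"
      by (metis linorder_neqE_nat)
    then have "all_inst_derivable N ({#A i (c i), A j (c j)#} \<turnstile> {#})"
      using inj[of i j "c i"] base by simp
    moreover have "set_mset {#A i (c i), A j (c j)#} \<subseteq> (\<lambda>i. A i (c i)) ` {..<n + 2}"
      using ij by (simp add: image_eqI[of _ _ i] image_eqI[of _ _ j])
    ultimately show ?case by blast
  next
    case (step m)
    let ?S = "(\<lambda>i. A i (c i)) ` {..<m}"
    \<comment> \<open>The children of the node are the updates of \<open>c\<close> at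
      \<open>m\<close>; decisions below \<open>m\<close> are unaffected.\<close>
    have upd: "(\<lambda>i. A i ((c(m := k)) i)) ` {..<Suc m} = insert (A m k) ?S" for k
      by (auto simp: lessThan_Suc)
    have ex: "\<exists>\<Gamma>. set_mset \<Gamma> \<subseteq> insert (A m k) ?S \<and> all_inst_derivable N (\<Gamma> \<turnstile> {#})"
      if "k \<le> n" for k
      using step.IH[of "c(m := k)"] step.prems that unfolding upd by simp
    show ?case
    proof (cases "\<exists>\<Gamma>. set_mset \<Gamma> \<subseteq> ?S \<and> all_inst_derivable N (\<Gamma> \<turnstile> {#})")
      \<comment> \<open>The opposite case is the goal itself and is closed by the final
        \<open>qed\<close>. Here every clause obtained from a child must contain
        \<open>A m k\<close>, so it can be resolved against \<open>total\<close> for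
        \<open>m\<close>.\<close>
      case False
      have "\<exists>\<Gamma>. set_mset \<Gamma> \<subseteq> ?S \<and> all_inst_derivable N (add_mset (A m k) \<Gamma> \<turnstile> {#})"
        if k: "k \<in># mset [0..<Suc n]" for k
      proof -
        from k have "k \<le> n" by auto
        from ex[OF this] obtain \<Gamma> where \<Gamma>: "set_mset \<Gamma> \<subseteq> insert (A m k) ?S"
          "all_inst_derivable N (\<Gamma> \<turnstile> {#})" by blast
        with False have "A m k \<in># \<Gamma>" by blast
        then obtain \<Gamma>' where \<Gamma>': "\<Gamma> = add_mset (A m k) \<Gamma>'" by (metis multi_member_split)
        from all_inst_derivable_merge_left[OF \<Gamma>(2)[unfolded \<Gamma>']] obtain \<Gamma>'' where
          "set_mset \<Gamma>'' \<subseteq> set_mset \<Gamma>' - {A m k}"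
          "all_inst_derivable N (add_mset (A m k) \<Gamma>'' \<turnstile> {#})" by blast
        moreover from this(1) have "set_mset \<Gamma>'' \<subseteq> ?S" using \<Gamma>(1) \<Gamma>' by auto
        ultimately show ?thesis by blast
      qed
      then show ?thesis
        using eliminate_disjuncts[OF total[of m], of ?S] by simp
    qed
  qed
  \<comment> \<open>At the root nothing is decided, so \<open>\<Gamma>\<close> is empty; the
    constant 0 only has to respect the bound \<open>n\<close>.\<close>
  from this[of 0 "\<lambda>_. 0"] show ?thesis by auto
qed

section \<open>The increasing chain of terms\<close>

text \<open>The clause set has no transitivity axiom for the order. The maximum replaces it: from an
  upper bound of \<open>chain (Suc j)\<close>, (C2) gives the bound for
  \<open>Succ (chain j)\<close> and (C3) the one for \<open>chain j\<close>.\<close>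

primrec chain :: "nat \<Rightarrow> tm" where
  "chain 0 = Zero"
| "chain (Suc j) = Maxi (Succ (chain j)) (chain j)"

lemma liftable_refl: "liftable (clause_set n) ({#} \<turnstile> {#Leq t t#})"
  using liftable_initial[of "{#} \<turnstile> {#Leq \<alpha> \<alpha>#}" "clause_set n" "\<lambda>_. t"]
  by (simp add: clause_set_def)

lemma liftable_Maxi_left:
  "liftable (clause_set n) ({#Leq (Maxi t u) v#} \<turnstile> {#Leq t v#})"
  \<comment> \<open>The default value \<open>v\<close> serves \<gamma>, which is variable 2.\<close>
  using liftable_initial[of "{#Leq (Maxi \<alpha> \<beta>) \<gamma>#} \<turnstile> {#Leq \<alpha> \<gamma>#}" "clause_set n"
      "(\<lambda>_. v)(0 := t, 1 := u)"]
  by (simp add: clause_set_def)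

lemma liftable_Maxi_right:
  "liftable (clause_set n) ({#Leq (Maxi t u) v#} \<turnstile> {#Leq u v#})"
  using liftable_initial[of "{#Leq (Maxi \<alpha> \<beta>) \<gamma>#} \<turnstile> {#Leq \<beta> \<gamma>#}" "clause_set n"
      "(\<lambda>_. v)(0 := t, 1 := u)"]
  by (simp add: clause_set_def)

lemma liftable_fun_eq_increasing:
  assumes "k \<le> n"
  shows "liftable (clause_set n) ({#fun_eq u k, fun_eq t k, Leq (Succ u) t#} \<turnstile> {#})"
proof -
  have "({#fun_eq \<beta> k, fun_eq \<alpha> k, Leq (Succ \<beta>) \<alpha>#} \<turnstile> {#}) \<in> clause_set n"
    using assms by (auto simp: clause_set_def)
  \<comment> \<open>The default value \<open>u\<close> serves \<beta>, which is variable 1.\<close>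
  from liftable_initial[OF this, of "(\<lambda>_. u)(0 := t)"] show ?thesis by simp
qed

lemma liftable_fun_eq_total:
  "liftable (clause_set n) ({#} \<turnstile> image_mset (fun_eq t) (mset [0..<Suc n]))"
proof -
  have "({#} \<turnstile> image_mset (fun_eq \<alpha>) (mset [0..<Suc n])) \<in> clause_set n"
    by (simp add: clause_set_def)
  from liftable_initial[OF this, of "\<lambda>_. t"] show ?thesis
    by (simp add: image_mset.compositionality comp_def)
qed

lemma liftable_unit_resolution:
  assumes "liftable N ({#} \<turnstile> {#P#})" and "liftable N ({#P#} \<turnstile> {#Q#})"
  shows "liftable N ({#} \<turnstile> {#Q#})"
  using all_inst_derivable_imp_liftable[OF all_inst_derivable_resolution, of N "{#}" P "{#}" "{#}"]
    assms by simp

text \<open>Starting from reflexivity at \<open>j\<close>, each use of (C3) lowers the left side by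
  one link while the right side stays fixed.\<close>

lemma liftable_chain_le:
  assumes "i \<le> j"
  shows "liftable (clause_set n) ({#} \<turnstile> {#Leq (chain i) (chain j)#})"
  using assms
proof (induction i rule: inc_induct)
  case base
  show ?case by (rule liftable_refl)
next
  case (step i)
  from liftable_unit_resolution[OF this(3)[unfolded chain.simps] liftable_Maxi_right]
  show ?case .
qed

lemma liftable_Succ_chain_le:
  assumes "i < j"
  shows "liftable (clause_set n) ({#} \<turnstile> {#Leq (Succ (chain i)) (chain j)#})"
proof -
  have "Suc i \<le> j" using assms by simp
  from liftable_unit_resolution[OF liftable_chain_le[OF this, unfolded chain.simps]
      liftable_Maxi_left]
  show ?thesis .
qed

text \<open>Instantiating (C4) with \<open>chain i\<close> for \<beta> and \<open>chain j\<close>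
  for \<alpha> makes its order atom the derived unit, which is resolved away.\<close>

lemma chain_values_distinct:
  assumes "i < j" and "k \<le> n"
  shows "all_inst_derivable (clause_set n) ({#fun_eq (chain i) k, fun_eq (chain j) k#} \<turnstile> {#})"
  using all_inst_derivable_resolution[OF liftable_Succ_chain_le[OF assms(1), of n],
      of "{#fun_eq (chain i) k, fun_eq (chain j) k#}" "{#}"]
    liftable_fun_eq_increasing[OF assms(2), of "chain i" "chain j"]
  by (simp add: add_mset_commute)

theorem theorem2:
  fixes n :: nat
  shows "derivable (clause_set n) ({#} \<turnstile> {#})"
proof (rule all_inst_derivable_imp_derivable, rule pigeonhole_refutation)
  show "liftable (clause_set n) ({#} \<turnstile> image_mset (fun_eq (chain i)) (mset [0..<Suc n]))" for i
    by (rule liftable_fun_eq_total)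
qed (rule chain_values_distinct)

end
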